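(* Consider the following map from multi-edge trees to unary-binary trees. Given a multi-edge tree, ignore the multiplicities and apply the classical rotation correspondence to obtain a binary tree, whose internal nodes correspond to the non-root nodes of the ordered tree. Then, for each non-root node of the ordered tree whose edge from its parent has multiplicity $b$, insert $b-1$ extra nodes in a chain on top of the corresponding node of the binary tree, connected by unary branches. For every $N\ge 0$, this map is a bijection from the set of multi-edge trees with $N$ edges (counting multiplicities) to the set of unary-binary trees with $N$ internal nodes.
   Context: A multi-edge tree is an ordered (plane rooted) tree in which every edge carries a label, its multiplicity, which is an integer $\ge 1$ (thought of as that many parallel edges); its number of edges counting multiplicities is the sum of the labels. Unary-binary trees form the family $\mathscr{M}$ defined recursively: a tree in $\mathscr{M}$ is either the empty tree $\square$ (with $0$ internal nodes); or an internal node with an ordered pair (left, right) of subtrees in $\mathscr{M}$, possibly empty; or an internal node with a single unary branch to a nonempty tree of $\mathscr{M}$. Binary trees are those without unary branches. The classical rotation correspondence maps an ordered tree with $n$ edges to a binary tree with $n$ internal nodes: the internal nodes are the non-root nodes of the ordered tree; the root of the binary tree is the leftmost child of the root of the ordered tree (the binary tree is empty if there is none); the left child of a node is its leftmost child in the ordered tree, and the right child of a node is its next sibling to the right in the ordered tree (an empty subtree being used whenever such a node does not exist). *)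

theory Defs
  imports Main "HOL-Library.Tree"
begin

(* The label in a pair is carried by the edge from the root to the root of the paired subtree. *)
datatype 'a otree = ONode (branches: "('a \<times> 'a otree) list")

definition multi_edge_trees :: "nat otree set" where
  "multi_edge_trees = {t. \<forall>b \<in> set_otree t. b \<ge> 1}"

primrec num_edges :: "nat otree \<Rightarrow> nat" where
  "num_edges (ONode ts) = (\<Sum>(b, k) \<leftarrow> map (map_prod id num_edges) ts. b + k)"

datatype ubtree = Empty | Unary ubtree | Binary ubtree ubtree

(* The side condition in unary excludes a unary branch to the empty tree. *)
inductive_set unary_binary_trees :: "ubtree set" where
  empty: "Empty \<in> unary_binary_trees"
| binary: "l \<in> unary_binary_trees \<Longrightarrow> r \<in> unary_binary_trees \<Longrightarrow>
    Binary l r \<in> unary_binary_trees"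
| unary: "t \<in> unary_binary_trees \<Longrightarrow> t \<noteq> Empty \<Longrightarrow> Unary t \<in> unary_binary_trees"

primrec internal_nodes :: "ubtree \<Rightarrow> nat" where
  "internal_nodes Empty = 0"
| "internal_nodes (Unary t) = Suc (internal_nodes t)"
| "internal_nodes (Binary l r) = Suc (internal_nodes l + internal_nodes r)"

(* The argument lists a non-root node followed by its siblings to the right; the corresponding
   internal node of the binary tree keeps the label of the edge from its parent. *)
fun rotation_forest :: "('a \<times> 'a otree) list \<Rightarrow> 'a tree" where
  "rotation_forest [] = Leaf"
| "rotation_forest ((b, ONode us) # ts) = Node (rotation_forest us) b (rotation_forest ts)"

definition rotation :: "'a otree \<Rightarrow> 'a tree" where
  "rotation t = rotation_forest (branches t)"

(* The labels do not influence the rotation, they are only transported along it: taking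
   f constant gives the rotation of the tree without multiplicities. *)
lemma rotation_forest_map:
  "rotation_forest (map (map_prod f (map_otree f)) ts) = map_tree f (rotation_forest ts)"
  by (induction ts rule: rotation_forest.induct) auto

lemma rotation_map_otree: "rotation (map_otree f t) = map_tree f (rotation t)"
  by (cases t) (simp add: rotation_def rotation_forest_map)

primrec insert_chains :: "nat tree \<Rightarrow> ubtree" where
  "insert_chains Leaf = Empty"
| "insert_chains (Node l b r) =
    (Unary ^^ (b - 1)) (Binary (insert_chains l) (insert_chains r))"

definition unary_binary_of :: "nat otree \<Rightarrow> ubtree" where
  "unary_binary_of t = insert_chains (rotation t)"

end

theory Submission
  imports Defs
begin

text \<open>
  The map is a composition of two bijections through binary trees whose nodes carry positive
  labels. The rotation is invertible because an ordered forest and a binary tree have the same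
  recursive structure: either empty, or a label together with two smaller objects (for a forest,
  the children of its first root and the remaining trees). It keeps the multiset of labels, so a
  positively labelled ordered tree becomes a positively labelled binary tree.

  Inserting chains is invertible because every nonempty unary-binary tree begins with a maximal
  unary chain, say with \<open>k\<close> nodes. The chain ends at a binary node, as no unary branch leads to
  the empty tree, and so \<open>k + 1\<close> is the only possible label of that node. Since a label \<open>b \<ge> 1\<close>
  yields \<open>b - 1\<close> unary nodes and one binary node, the number of internal nodes is the sum of the
  labels, which is the number of edges; hence the bijection restricts to each value of \<open>N\<close>.
\<close>

fun unrotation_forest :: "'a tree \<Rightarrow> ('a \<times> 'a otree) list" where
  "unrotation_forest Leaf = []"
| "unrotation_forest (Node l b r) = (b, ONode (unrotation_forest l)) # unrotation_forest r"

lemma unrotation_rotation_forest: "unrotation_forest (rotation_forest ts) = ts"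
  by (induction ts rule: rotation_forest.induct) auto

lemma rotation_unrotation_forest: "rotation_forest (unrotation_forest t) = t"
  by (induction t) auto

lemma set_tree_rotation_forest: "set_tree (rotation_forest ts) = set_otree (ONode ts)"
  by (induction ts rule: rotation_forest.induct) auto

lemma set_tree_rotation: "set_tree (rotation t) = set_otree t"
  by (cases t) (simp add: rotation_def set_tree_rotation_forest)

lemma bij_rotation: "bij rotation"
proof (rule o_bij)
  show "(ONode \<circ> unrotation_forest) \<circ> rotation = id"
    by (rule ext) (simp add: rotation_def unrotation_rotation_forest)
  show "rotation \<circ> (ONode \<circ> unrotation_forest) = id"
    by (rule ext) (simp add: rotation_def rotation_unrotation_forest)
qed

lemma bij_betw_rotation_multi_edge_trees:
  "bij_betw rotation multi_edge_trees {t. \<forall>b \<in> set_tree t. b \<ge> 1}"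
proof -
  have "rotation ` multi_edge_trees = {t. \<forall>b \<in> set_tree t. b \<ge> 1}"
  proof (intro equalityI subsetI)
    fix t :: "nat tree" assume t: "t \<in> {t. \<forall>b \<in> set_tree t. b \<ge> 1}"
    obtain s where s: "t = rotation s"
      using bij_is_surj[OF bij_rotation] by (rule surjE)
    show "t \<in> rotation ` multi_edge_trees"
      using t by (simp add: s multi_edge_trees_def set_tree_rotation)
  qed (auto simp: multi_edge_trees_def set_tree_rotation)
  then show ?thesis
    unfolding bij_betw_def using inj_on_subset[OF bij_is_inj[OF bij_rotation]] by blast
qed

text \<open>
  The inverse of the insertion of chains deletes a unary node by adding 1 to the label of the
  root below it. The value \<open>Leaf\<close> in the middle equation arises only from a unary chain that ends
  in the empty tree, which is excluded in unary-binary trees.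
\<close>
fun contract_chains :: "ubtree \<Rightarrow> nat tree" where
  "contract_chains Empty = Leaf"
| "contract_chains (Unary t) =
    (case contract_chains t of Leaf \<Rightarrow> Leaf | Node l b r \<Rightarrow> Node l (Suc b) r)"
| "contract_chains (Binary l r) = Node (contract_chains l) 1 (contract_chains r)"

lemma contract_chains_chain:
  "contract_chains ((Unary ^^ k) (Binary l r)) = Node (contract_chains l) (Suc k) (contract_chains r)"
  by (induction k) auto

lemma contract_insert_chains:
  "\<forall>b \<in> set_tree t. b \<ge> 1 \<Longrightarrow> contract_chains (insert_chains t) = t"
  by (induction t) (auto simp: contract_chains_chain)

lemma contract_chains_eq_Leaf_iff:
  "u \<in> unary_binary_trees \<Longrightarrow> contract_chains u = Leaf \<longleftrightarrow> u = Empty"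
  by (induction rule: unary_binary_trees.induct) (auto split: tree.split)

lemma contract_chains_pos:
  "b \<in> set_tree (contract_chains u) \<Longrightarrow> b \<ge> 1"
  by (induction u) (auto split: tree.splits)

text \<open>
  A nonempty subtree below a unary branch contracts to a tree whose root has some label \<open>b \<ge> 1\<close>,
  where positivity matters: on the natural numbers, raising the label to \<open>b + 1\<close> lengthens the
  chain from \<open>b - 1\<close> to \<open>b\<close> nodes only if \<open>b \<noteq> 0\<close>.
\<close>
lemma insert_contract_chains:
  "u \<in> unary_binary_trees \<Longrightarrow> insert_chains (contract_chains u) = u"
proof (induction rule: unary_binary_trees.induct)
  case (unary u)
  obtain l b r where c: "contract_chains u = Node l b r"
    using unary.hyps contract_chains_eq_Leaf_iff by (cases "contract_chains u") auto
  have "b \<ge> 1"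
    using contract_chains_pos[of b u] c by simp
  then obtain k where "b = Suc k"
    by (cases b) auto
  then show ?case
    using unary.IH c by simp
qed auto

lemma chain_in_unary_binary_trees:
  assumes "l \<in> unary_binary_trees" "r \<in> unary_binary_trees"
  shows "(Unary ^^ k) (Binary l r) \<in> unary_binary_trees"
proof (induction k)
  case 0
  show ?case using assms by (simp add: unary_binary_trees.binary)
next
  case (Suc k)
  have "(Unary ^^ k) (Binary l r) \<noteq> Empty"
    by (cases k) auto
  then show ?case using Suc by (simp add: unary_binary_trees.unary)
qed

lemma insert_chains_in_unary_binary_trees: "insert_chains t \<in> unary_binary_trees"
  by (induction t) (auto intro: unary_binary_trees.empty chain_in_unary_binary_trees)

lemma bij_betw_insert_chains:
  "bij_betw insert_chains {t. \<forall>b \<in> set_tree t. b \<ge> 1} unary_binary_trees"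
proof (rule bij_betw_byWitness)
  show "\<forall>t \<in> {t. \<forall>b \<in> set_tree t. b \<ge> 1}. contract_chains (insert_chains t) = t"
    by (blast intro: contract_insert_chains)
  show "\<forall>u \<in> unary_binary_trees. insert_chains (contract_chains u) = u"
    by (blast intro: insert_contract_chains)
  show "insert_chains ` {t. \<forall>b \<in> set_tree t. b \<ge> 1} \<subseteq> unary_binary_trees"
    by (blast intro: insert_chains_in_unary_binary_trees)
  show "contract_chains ` unary_binary_trees \<subseteq> {t. \<forall>b \<in> set_tree t. b \<ge> 1}"
    by (blast intro: contract_chains_pos)
qed

lemma internal_nodes_chain: "internal_nodes ((Unary ^^ k) u) = k + internal_nodes u"
  by (induction k) auto

text \<open>
  Positivity of the labels makes \<open>(b - 1) + 1 = b\<close> on the natural numbers: a label 0 would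
  contribute one internal node but no edge.
\<close>
lemma internal_nodes_insert_chains_rotation_forest:
  "\<forall>b \<in> set_tree (rotation_forest ts). b \<ge> 1 \<Longrightarrow>
    internal_nodes (insert_chains (rotation_forest ts)) = num_edges (ONode ts)"
  by (induction ts rule: rotation_forest.induct) (auto simp: internal_nodes_chain)

lemma internal_nodes_unary_binary_of:
  assumes "t \<in> multi_edge_trees"
  shows "internal_nodes (unary_binary_of t) = num_edges t"
proof -
  have "\<forall>b \<in> set_tree (rotation_forest (branches t)). b \<ge> 1"
    using assms by (simp add: multi_edge_trees_def set_tree_rotation flip: rotation_def)
  then show ?thesis
    unfolding unary_binary_of_def rotation_def
    by (simp only: internal_nodes_insert_chains_rotation_forest otree.collapse)
qed

theorem mainTheorem5:
  fixes N :: nat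
  shows "bij_betw unary_binary_of
    {t \<in> multi_edge_trees. num_edges t = N}
    {u \<in> unary_binary_trees. internal_nodes u = N}"
proof -
  have "unary_binary_of = insert_chains \<circ> rotation"
    by (rule ext) (simp add: unary_binary_of_def)
  then have bij: "bij_betw unary_binary_of multi_edge_trees unary_binary_trees"
    using bij_betw_trans[OF bij_betw_rotation_multi_edge_trees bij_betw_insert_chains] by simp
  show ?thesis
  proof (rule bij_betw_subset[OF bij])
    show "unary_binary_of ` {t \<in> multi_edge_trees. num_edges t = N} =
        {u \<in> unary_binary_trees. internal_nodes u = N}"
      unfolding bij_betw_imp_surj_on[OF bij, symmetric]
      by (auto simp: internal_nodes_unary_binary_of)
  qed blast
qed

end
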